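(* Let $\mathbf{x}=\mathbf{x}(u,v,w)$ be a smooth immersed parametrized hypersurface in $\mathbb{E}^4$ with first and second fundamental form matrices $$I=\begin{pmatrix} E & F & A \\ F & G & B \\ A & B & C \end{pmatrix},\qquad II=\begin{pmatrix} L & M & P \\ M & N & T \\ P & T & V \end{pmatrix},$$ and let $\mathfrak{C}_0,\mathfrak{C}_1,\mathfrak{C}_2,\mathfrak{C}_3$ be its $i$-th curvatures. Then $\mathfrak{C}_0=1$ (by definition) and $$\mathfrak{C}_1=\frac{(EN+GL-2FM)C+(EG-F^2)V-LB^2-NA^2-2(APG-BPF-ATF+BTE-ABM)}{3\left[(EG-F^2)C-EB^2+2FAB-GA^2\right]},$$ $$\mathfrak{C}_2=\frac{(EN+GL-2FM)V+(LN-M^2)C-ET^2-GP^2-2(APN-BPM-ATM+BTL-PTF)}{3\left[(EG-F^2)C-EB^2+2FAB-GA^2\right]},$$ $$\mathfrak{C}_3=\frac{(LN-M^2)V-LT^2+2MPT-NP^2}{(EG-F^2)C-EB^2+2FAB-GA^2}.$$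
   Context: $\mathbb{E}^4$ is $\mathbb{R}^4$ with its standard inner product $\langle\cdot,\cdot\rangle$. Let $\mathbf{G}$ be the unit normal (Gauss map) $\mathbf{G}=\frac{\mathbf{x}_u\times\mathbf{x}_v\times\mathbf{x}_w}{\|\mathbf{x}_u\times\mathbf{x}_v\times\mathbf{x}_w\|}$, where $\times$ is the triple vector product in $\mathbb{E}^4$. The entries of $I$ are $E=\langle\mathbf{x}_u,\mathbf{x}_u\rangle$, $F=\langle\mathbf{x}_u,\mathbf{x}_v\rangle$, $G=\langle\mathbf{x}_v,\mathbf{x}_v\rangle$, $A=\langle\mathbf{x}_u,\mathbf{x}_w\rangle$, $B=\langle\mathbf{x}_v,\mathbf{x}_w\rangle$, $C=\langle\mathbf{x}_w,\mathbf{x}_w\rangle$; the entries of $II$ are $L=\langle\mathbf{x}_{uu},\mathbf{G}\rangle$, $M=\langle\mathbf{x}_{uv},\mathbf{G}\rangle$, $N=\langle\mathbf{x}_{vv},\mathbf{G}\rangle$, $P=\langle\mathbf{x}_{uw},\mathbf{G}\rangle$, $T=\langle\mathbf{x}_{vw},\mathbf{G}\rangle$, $V=\langle\mathbf{x}_{ww},\mathbf{G}\rangle$. The shape operator matrix is $\mathbf{S}=I^{-1}\cdot II$. The $i$-th curvatures $\mathfrak{C}_i$ ($i=0,\dots,3$) are defined by $\binom{3}{i}\mathfrak{C}_i=s_i$, where $s_i$ is the $i$-th elementary symmetric function of the eigenvalues (principal curvatures) of $\mathbf{S}$, with $s_0=1$. Equivalently, if $\det(\mathbf{S}-\lambda I_3)=a\lambda^3+b\lambda^2+c\lambda+d$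 ($I_3$ the identity matrix), then $\mathfrak{C}_0=1$, $3\mathfrak{C}_1=-b/a$, $3\mathfrak{C}_2=c/a$, $\mathfrak{C}_3=-d/a$. *)

theory Defs
  imports "HOL-Analysis.Analysis" "HOL-Computational_Algebra.Polynomial"
begin

definition partial :: "'n \<Rightarrow> (real^'n \<Rightarrow> 'b::real_normed_vector) \<Rightarrow> real^'n \<Rightarrow> 'b"
  where "partial i f = (\<lambda>p. frechet_derivative f (at p) (axis i 1))"

(* C^k on an open set U: for open U the unrestricted derivative in "partial" agrees
   with the derivative within U. *)
primrec Ck_on :: "nat \<Rightarrow> (real^'n \<Rightarrow> 'b::real_normed_vector) \<Rightarrow> (real^'n) set \<Rightarrow> bool" where
  "Ck_on 0 f U \<longleftrightarrow> continuous_on U f"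
| "Ck_on (Suc k) f U \<longleftrightarrow> f differentiable_on U \<and> (\<forall>i. Ck_on k (partial i f) U)"

definition smooth_on :: "(real^'n \<Rightarrow> 'b::real_normed_vector) \<Rightarrow> (real^'n) set \<Rightarrow> bool"
  where "smooth_on f U \<longleftrightarrow> (\<forall>k. Ck_on k f U)"

definition immersed_hypersurface :: "(real^3 \<Rightarrow> real^4) \<Rightarrow> (real^3) set \<Rightarrow> bool"
  where "immersed_hypersurface x U \<longleftrightarrow>
    open U \<and> smooth_on x U \<and> (\<forall>p\<in>U. inj (frechet_derivative x (at p)))"

(* The formal determinant with rows (e1, e2, e3, e4), a, b, c: its component along e_i
   is obtained by replacing the first row by the i-th unit vector. *)
definition triple_product :: "real^4 \<Rightarrow> real^4 \<Rightarrow> real^4 \<Rightarrow> real^4"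
  where "triple_product a b c = (\<chi> i. det (vector [axis i 1, a, b, c] :: real^4^4))"

(* The parameters u, v, w are the coordinates 1, 2, 3 of the parameter space. *)
definition gauss_map :: "(real^3 \<Rightarrow> real^4) \<Rightarrow> real^3 \<Rightarrow> real^4"
  where "gauss_map x p =
    (let n = triple_product (partial 1 x p) (partial 2 x p) (partial 3 x p)
     in n /\<^sub>R norm n)"

definition first_form :: "(real^3 \<Rightarrow> real^4) \<Rightarrow> real^3 \<Rightarrow> real^3^3"
  where "first_form x p =
    (let xu = partial 1 x p; xv = partial 2 x p; xw = partial 3 x p
     in vector [vector [xu \<bullet> xu, xu \<bullet> xv, xu \<bullet> xw],
                vector [xu \<bullet> xv, xv \<bullet> xv, xv \<bullet> xw],
                vector [xu \<bullet> xw, xv \<bullet> xw, xw \<bullet> xw]])"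

definition second_form :: "(real^3 \<Rightarrow> real^4) \<Rightarrow> real^3 \<Rightarrow> real^3^3"
  where "second_form x p =
    (let xu = partial 1 x; xv = partial 2 x; xw = partial 3 x;
         xuu = partial 1 xu p; xuv = partial 2 xu p; xvv = partial 2 xv p;
         xuw = partial 3 xu p; xvw = partial 3 xv p; xww = partial 3 xw p;
         n = gauss_map x p
     in vector [vector [xuu \<bullet> n, xuv \<bullet> n, xuw \<bullet> n],
                vector [xuv \<bullet> n, xvv \<bullet> n, xvw \<bullet> n],
                vector [xuw \<bullet> n, xvw \<bullet> n, xww \<bullet> n]])"

definition shape_operator :: "(real^3 \<Rightarrow> real^4) \<Rightarrow> real^3 \<Rightarrow> real^3^3"
  where "shape_operator x p = matrix_inv (first_form x p) ** second_form x p"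

(* det (S - X I) as a polynomial in X *)
definition charpoly :: "real^'n^'n \<Rightarrow> real poly"
  where "charpoly S = det (\<chi> i j. [:S $ i $ j:] - (if i = j then [:0, 1:] else 0))"

(* Real eigenvalues, repeated according to their algebraic multiplicity *)
definition eigenvalues :: "real^'n^'n \<Rightarrow> real multiset"
  where "eigenvalues S = proots (charpoly S)"

definition principal_curvatures :: "(real^3 \<Rightarrow> real^4) \<Rightarrow> real^3 \<Rightarrow> real list"
  where "principal_curvatures x p = sorted_list_of_multiset (eigenvalues (shape_operator x p))"

(* Summing over index sets (not over sets of values) keeps repeated entries. *)
definition elementary_symmetric :: "nat \<Rightarrow> real list \<Rightarrow> real"
  where "elementary_symmetric i ks =
    (\<Sum>J | J \<subseteq> {..<length ks} \<and> card J = i. \<Prod>j\<in>J. ks ! j)"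

definition curvature :: "nat \<Rightarrow> (real^3 \<Rightarrow> real^4) \<Rightarrow> real^3 \<Rightarrow> real"
  where "curvature i x p =
    elementary_symmetric i (principal_curvatures x p) / real (3 choose i)"

end

theory Submission
  imports Defs "HOL-Computational_Algebra.Fundamental_Theorem_Algebra"
begin

text \<open>The first form is positive definite because \<open>x\<close> is an immersion, so the pencil \<open>II - t I\<close> of
  symmetric matrices has only real roots. Hence the list of principal curvatures, which records real
  roots only, has length 3, and \<open>det I * (k1 - t) * (k2 - t) * (k3 - t) = det (II - t I)\<close>. Comparing
  the coefficients in \<open>t\<close> gives the three formulas.\<close>

section \<open>Passing from real to complex polynomials, and the characteristic polynomial as a
  determinant\<close>

lemma map_poly_of_real_add:
  "map_poly of_real (p + q) =
    (map_poly of_real p + map_poly of_real q :: 'a::{real_algebra_1,comm_ring_1} poly)"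
  by (rule poly_eqI) (simp add: coeff_map_poly)

lemma map_poly_of_real_mult:
  "map_poly of_real (p * q) =
    (map_poly of_real p * map_poly of_real q :: 'a::{real_algebra_1,comm_ring_1} poly)"
  by (rule poly_eqI) (simp add: coeff_map_poly coeff_mult)

lemma map_poly_of_real_sum:
  "map_poly of_real (sum f A) =
    (\<Sum>x\<in>A. map_poly of_real (f x) :: 'a::{real_algebra_1,comm_ring_1} poly)"
  by (induction A rule: infinite_finite_induct) (simp_all add: map_poly_of_real_add)

lemma map_poly_of_real_prod:
  "map_poly of_real (prod f A) =
    (\<Prod>x\<in>A. map_poly of_real (f x) :: 'a::{real_algebra_1,comm_ring_1} poly)"
  by (induction A rule: infinite_finite_induct) (simp_all add: map_poly_of_real_mult)

lemma map_poly_of_real_of_int: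
  "map_poly of_real (of_int k) = (of_int k :: 'a::{real_algebra_1,comm_ring_1} poly)"
  by (simp add: of_int_poly map_poly_pCons)

lemma poly_map_poly_of_real:
  "poly (map_poly of_real p) (of_real t) =
    (of_real (poly p t) :: 'a::{real_algebra_1,comm_ring_1})"
  by (induction p) (simp_all add: map_poly_pCons)

text \<open>Base change and evaluation are ring homomorphisms, so they commute with the sum of
  signed products that defines \<open>det\<close>.\<close>

lemma poly_map_poly_of_real_det:
  fixes M :: "real poly^'n^'n"
  shows "poly (map_poly of_real (det M)) z =
    det (\<chi> i j. poly (map_poly of_real (M $ i $ j)) (z :: complex))"
  by (simp add: det_def map_poly_of_real_sum map_poly_of_real_mult map_poly_of_real_prod
      map_poly_of_real_of_int poly_sum poly_prod)

lemma poly_charpoly_complex: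
  "poly (map_poly of_real (charpoly S)) z =
    det (\<chi> i j. of_real (S $ i $ j) - (if i = j then (z :: complex) else 0))"
proof -
  have "poly (map_poly of_real ([:S $ i $ j:] - (if i = j then [:0, 1:] else 0))) z =
    of_real (S $ i $ j) - (if i = j then z else 0)" for i j
    by (simp add: map_poly_pCons)
  then show ?thesis
    by (simp add: charpoly_def poly_map_poly_of_real_det)
qed

lemma poly_charpoly: "poly (charpoly S) t = det (S - mat t)"
proof -
  have "poly ([:S $ i $ j:] - (if i = j then [:0, 1:] else 0)) t = (S - mat t) $ i $ j" for i j
    by (simp add: mat_def)
  then show ?thesis
    by (simp add: charpoly_def det_def poly_sum poly_prod)
qed

section \<open>Splitting of real-rooted polynomials, and real-rootedness for a self-adjoint
  pencil\<close>

lemma real_rooted_splits: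
  fixes f :: "real poly"
  assumes "f \<noteq> 0"
    and "\<And>z::complex. poly (map_poly of_real f) z = 0 \<Longrightarrow> z \<in> \<real>"
  shows "size (proots f) = degree f \<and> f = smult (lead_coeff f) (\<Prod>a\<in>#proots f. [:-a, 1:])"
  using assms
proof (induction "degree f" arbitrary: f rule: less_induct)
  case less
  show ?case
  proof (cases "degree f = 0")
    case True
    then obtain c where "f = [:c:]" by (rule degree_eq_zeroE)
    then show ?thesis by simp
  next
    case False
    have "degree (map_poly of_real f :: complex poly) = degree f"
      by (simp add: degree_map_poly)
    with False have "\<not> constant (poly (map_poly of_real f :: complex poly))"
      by (simp add: constant_degree)
    \<comment> \<open>The complex root is real by hypothesis, so a linear factor splits off over the
      reals; every root of the cofactor \<open>g\<close> is a root of \<open>f\<close>, hence the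
      induction hypothesis applies to \<open>g\<close>.\<close>
    then obtain z :: complex where z: "poly (map_poly of_real f) z = 0"
      using fundamental_theorem_of_algebra by blast
    then obtain r where "z = of_real r"
      using less.prems(2) by (meson Reals_cases)
    with z have "(of_real (poly f r) :: complex) = 0"
      by (simp add: poly_map_poly_of_real)
    then have "[:-r, 1:] dvd f"
      by (simp add: poly_eq_0_iff_dvd)
    then obtain g where f: "f = [:-r, 1:] * g" by (elim dvdE)
    with less.prems(1) have "g \<noteq> 0" by auto
    then have deg: "degree f = Suc (degree g)"
      unfolding f by (subst degree_mult_eq) auto
    have "size (proots g) = degree g \<and> g = smult (lead_coeff g) (\<Prod>a\<in>#proots g. [:-a, 1:])"
    proof (rule less.hyps)
      show "z \<in> \<real>" if "poly (map_poly of_real g) z = 0" for z :: complex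
        using less.prems(2)[of z] that by (simp only: f map_poly_of_real_mult poly_mult) simp
    qed (use deg \<open>g \<noteq> 0\<close> in auto)
    moreover have "proots f = add_mset r (proots g)"
      using \<open>g \<noteq> 0\<close> unfolding f by (subst proots_mult) auto
    moreover have "lead_coeff f = lead_coeff g"
      unfolding f by (subst lead_coeff_mult) simp
    ultimately show ?thesis
      using f deg by (metis image_mset_add_mset mult_smult_right prod_mset.add_mset size_add_mset)
  qed
qed

text \<open>If \<open>u + i w\<close> is an eigenvector for \<open>a + i b\<close>, then pairing the real part of
  \<open>H (u + i w) = (a + i b) K (u + i w)\<close> with \<open>w\<close> and its imaginary part with \<open>u\<close> gives
  \<open>b (u \<bullet> K u + w \<bullet> K w) = 0\<close>.\<close>

lemma self_adjoint_pencil_roots_real: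
  fixes K H :: "real^'n^'n" and z :: complex
  assumes symK: "transpose K = K" and symH: "transpose H = H"
    and pos: "\<And>v. v \<noteq> 0 \<Longrightarrow> v \<bullet> (K *v v) > 0"
    and S: "K ** S = H"
    and root: "poly (map_poly of_real (charpoly S)) z = 0"
  shows "z \<in> \<real>"
proof -
  let ?M = "\<chi> i j. of_real (S $ i $ j) - (if i = j then (z :: complex) else 0)"
  have "\<not> invertible ?M"
    using root by (simp add: poly_charpoly_complex invertible_det_nz)
  then obtain v where v: "?M *v v = 0" "v \<noteq> 0"
    by (meson invertible_left_inverse matrix_left_invertible_ker)
  define u w where "u = (\<chi> i. Re (v $ i))" and "w = (\<chi> i. Im (v $ i))"
  have eig: "(\<Sum>j\<in>UNIV. of_real (S $ i $ j) * v $ j) = z * v $ i" for i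
  proof -
    have "0 = (?M *v v) $ i" using v by simp
    also have "\<dots> = (\<Sum>j\<in>UNIV. of_real (S $ i $ j) * v $ j - (if i = j then z * v $ j else 0))"
      by (auto simp: matrix_vector_mult_def algebra_simps intro!: sum.cong)
    also have "\<dots> = (\<Sum>j\<in>UNIV. of_real (S $ i $ j) * v $ j) - z * v $ i"
      by (simp add: sum_subtractf)
    finally show ?thesis by simp
  qed
  have Su: "S *v u = Re z *\<^sub>R u - Im z *\<^sub>R w"
    using arg_cong[OF eig, of Re] by (simp add: vec_eq_iff matrix_vector_mult_def u_def w_def)
  have Sw: "S *v w = Re z *\<^sub>R w + Im z *\<^sub>R u"
    using arg_cong[OF eig, of Im] by (simp add: vec_eq_iff matrix_vector_mult_def u_def w_def)
  \<comment> \<open>\<open>S\<close> itself need not be symmetric; multiplying by \<open>K\<close>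
    replaces it by \<open>H\<close>, so that only the symmetric matrices \<open>H\<close> and
    \<open>K\<close> remain.\<close>
  have Hu: "H *v u = Re z *\<^sub>R (K *v u) - Im z *\<^sub>R (K *v w)"
    using arg_cong[OF Su, of "(*v) K"]
    by (simp add: matrix_vector_mul_assoc S matrix_vector_mult_diff_distrib matrix_vector_mult_scaleR)
  have Hw: "H *v w = Re z *\<^sub>R (K *v w) + Im z *\<^sub>R (K *v u)"
    using arg_cong[OF Sw, of "(*v) K"]
    by (simp add: matrix_vector_mul_assoc S matrix_vector_right_distrib matrix_vector_mult_scaleR)
  have "w \<bullet> (H *v u) = u \<bullet> (H *v w)" "w \<bullet> (K *v u) = u \<bullet> (K *v w)"
    by (metis dot_lmul_matrix inner_commute symH symK vector_transpose_matrix)+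
  then have "Im z * (u \<bullet> (K *v u) + w \<bullet> (K *v w)) = 0"
    by (simp add: Hu Hw inner_diff_right inner_add_right algebra_simps)
  \<comment> \<open>One of the two parts may vanish, but then its term is zero and the other one is
    positive.\<close>
  moreover have "u \<noteq> 0 \<or> w \<noteq> 0"
    using v(2) by (auto simp: u_def w_def vec_eq_iff complex_eq_iff)
  then have "u \<bullet> (K *v u) + w \<bullet> (K *v w) > 0"
    using pos[of u] pos[of w] by (cases "u = 0"; cases "w = 0") auto
  ultimately have "Im z = 0" by simp
  then show ?thesis by (simp add: complex_is_Real_iff)
qed

section \<open>Curvatures as symmetric functions of three principal curvatures\<close>

text \<open>The sign comes from using det (S - X I) instead of det (X I - S) in odd
  dimension.\<close>

lemma charpoly_3:
  fixes S :: "real^3^3"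
  shows "degree (charpoly S) = 3" "lead_coeff (charpoly S) = -1"
  by (simp_all add: charpoly_def det_3)

lemma Collect_subset_three_card:
  "{J. J \<subseteq> {..<3::nat} \<and> card J = 0} = {{}}"
  "{J. J \<subseteq> {..<3::nat} \<and> card J = 1} = {{0}, {1}, {2}}"
  "{J. J \<subseteq> {..<3::nat} \<and> card J = 2} = {{0, 1}, {0, 2}, {1, 2}}"
  "{J. J \<subseteq> {..<3::nat} \<and> card J = 3} = {{0, 1, 2}}"
proof -
  have "{..<3::nat} = {0, 1, 2}" by auto
  then have *: "{J. J \<subseteq> {..<3::nat} \<and> card J = i} = {J \<in> Pow {0, 1, 2}. card J = i}" for i
    by auto
  show "{J. J \<subseteq> {..<3::nat} \<and> card J = 0} = {{}}"
  "{J. J \<subseteq> {..<3::nat} \<and> card J = 1} = {{0}, {1}, {2}}"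
  "{J. J \<subseteq> {..<3::nat} \<and> card J = 2} = {{0, 1}, {0, 2}, {1, 2}}"
  "{J. J \<subseteq> {..<3::nat} \<and> card J = 3} = {{0, 1, 2}}"
    unfolding * Pow_insert Pow_empty by auto
qed

lemma elementary_symmetric_three:
  "elementary_symmetric 0 [a, b, c] = 1"
  "elementary_symmetric 1 [a, b, c] = a + b + c"
  "elementary_symmetric 2 [a, b, c] = a * b + a * c + b * c"
  "elementary_symmetric 3 [a, b, c] = a * b * c"
  \<comment> \<open>\<open>doubleton_eq_iff\<close> tells the three index pairs apart, so that the
    sum over them has three terms.\<close>
  using Collect_subset_three_card
  by (simp_all add: elementary_symmetric_def numeral_3_eq_3 doubleton_eq_iff)

lemma curvatures_from_roots:
  assumes "size (eigenvalues (shape_operator x p)) = 3"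
    and "charpoly (shape_operator x p) =
      - (\<Prod>k\<in>#eigenvalues (shape_operator x p). [:-k, 1:])"
  obtains a b c where "\<And>t. det (shape_operator x p - mat t) = (a - t) * (b - t) * (c - t)"
    and "curvature 0 x p = 1" "curvature 1 x p = (a + b + c) / 3"
    and "curvature 2 x p = (a * b + a * c + b * c) / 3" "curvature 3 x p = a * b * c"
proof -
  define ks where "ks = principal_curvatures x p"
  have ks: "mset ks = eigenvalues (shape_operator x p)"
    by (simp add: ks_def principal_curvatures_def)
  then have "length ks = 3"
    using assms(1) by (metis size_mset)
  then obtain a b c where abc: "ks = [a, b, c]"
    by (auto simp: numeral_3_eq_3 length_Suc_conv)
  show thesis
  proof (rule that)
    show "det (shape_operator x p - mat t) = (a - t) * (b - t) * (c - t)" for t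
      \<comment> \<open>With three factors the leading minus sign turns every t - k into k -
        t.\<close>
      unfolding poly_charpoly[symmetric]
      by (subst assms(2)) (simp add: ks[symmetric] abc algebra_simps)
  next
    have curv: "curvature i x p = elementary_symmetric i [a, b, c] / real (3 choose i)" for i
      by (simp add: curvature_def abc flip: ks_def)
    show "curvature 0 x p = 1"
      unfolding curv elementary_symmetric_three by simp
    show "curvature 1 x p = (a + b + c) / 3"
      unfolding curv elementary_symmetric_three by simp
    show "curvature 2 x p = (a * b + a * c + b * c) / 3"
      unfolding curv elementary_symmetric_three by (simp add: choose_two)
    show "curvature 3 x p = a * b * c"
      unfolding curv elementary_symmetric_three by simp
  qed
qed

section \<open>Positive definiteness and invertibility of the first form\<close>

text \<open>This links injectivity of the derivative to the partial derivatives from which the first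
  form is built.\<close>

lemma frechet_derivative_eq_sum_partial:
  assumes "f differentiable (at p)"
  shows "frechet_derivative f (at p) v = (\<Sum>i\<in>UNIV. v $ i *\<^sub>R partial i f p)"
proof -
  have lin: "linear (frechet_derivative f (at p))"
    using assms by (rule linear_frechet_derivative)
  have "frechet_derivative f (at p) (\<Sum>i\<in>UNIV. v $ i *\<^sub>R axis i 1) =
    (\<Sum>i\<in>UNIV. v $ i *\<^sub>R partial i f p)"
    by (simp add: linear_sum[OF lin] linear_scale[OF lin] partial_def)
  then show ?thesis
    by (simp add: basis_expansion flip: scalar_mult_eq_scaleR)
qed

text \<open>The first form is the Gram matrix of the three partial derivatives.\<close>

lemma first_form_quadratic:
  "v \<bullet> (first_form x p *v v) = (norm (\<Sum>i\<in>UNIV. v $ i *\<^sub>R partial i x p))\<^sup>2"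
proof -
  define a b c where "a = partial 1 x p" and "b = partial 2 x p" and "c = partial 3 x p"
  have "v \<bullet> (first_form x p *v v) =
      (v $ 1 *\<^sub>R a + v $ 2 *\<^sub>R b + v $ 3 *\<^sub>R c) \<bullet> (v $ 1 *\<^sub>R a + v $ 2 *\<^sub>R b + v $ 3 *\<^sub>R c)"
    unfolding first_form_def Let_def a_def[symmetric] b_def[symmetric] c_def[symmetric]
      inner_vec_def[of v]
    by (simp add: matrix_vector_mult_def sum_3 inner_add_left inner_add_right algebra_simps
        inner_commute[of b a] inner_commute[of c a] inner_commute[of c b])
  then show ?thesis
    by (simp add: power2_norm_eq_inner sum_3 a_def b_def c_def)
qed

text \<open>The quadratic form at \<open>v\<close> is the squared length of the derivative applied
  to \<open>v\<close>, which is nonzero by injectivity.\<close>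

lemma first_form_positive:
  assumes "immersed_hypersurface x U" "p \<in> U" "v \<noteq> 0"
  shows "v \<bullet> (first_form x p *v v) > 0"
proof -
  have "Ck_on (Suc 0) x U"
    using assms(1) unfolding immersed_hypersurface_def smooth_on_def by blast
  then have "x differentiable_on U" by simp
  moreover have "open U"
    using assms(1) by (simp add: immersed_hypersurface_def)
  ultimately have "x differentiable (at p)"
    using assms(2) by (simp add: differentiable_on_eq_differentiable_at)
  then have D: "linear (frechet_derivative x (at p))"
      "frechet_derivative x (at p) v = (\<Sum>i\<in>UNIV. v $ i *\<^sub>R partial i x p)"
    by (rule linear_frechet_derivative, rule frechet_derivative_eq_sum_partial)
  moreover have "inj (frechet_derivative x (at p))"
    using assms(1,2) by (simp add: immersed_hypersurface_def)
  ultimately have "(\<Sum>i\<in>UNIV. v $ i *\<^sub>R partial i x p) \<noteq> 0"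
    using assms(3) by (metis linear_injective_0)
  then show ?thesis by (simp add: first_form_quadratic)
qed

text \<open>A nonzero kernel vector \<open>v\<close> would give
  \<open>v \<bullet> (K *v v) = 0\<close>.\<close>

lemma invertible_of_positive:
  fixes K :: "real^'n^'n"
  assumes "\<And>v. v \<noteq> 0 \<Longrightarrow> v \<bullet> (K *v v) > 0"
  shows "invertible K"
  unfolding invertible_left_inverse matrix_left_invertible_ker
  using assms by (metis inner_zero_right less_irrefl)

text \<open>\<open>matrix_inv\<close> is a choice among two-sided inverses, and invertibility makes
  this choice meaningful.\<close>

lemma matrix_inv_right:
  fixes K :: "'a::semiring_1^'n^'m"
  assumes "invertible K"
  shows "K ** matrix_inv K = mat 1"
  using assms unfolding invertible_def matrix_inv_def by (rule someI2_ex) simp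

lemma transpose_symmetric_3:
  "transpose (vector [vector [a, b, c], vector [b, d, e], vector [c, e, f]] :: real^3^3) =
    vector [vector [a, b, c], vector [b, d, e], vector [c, e, f]]"
  by (simp add: vec_eq_iff transpose_def forall_3)

section \<open>Comparison of coefficients in the pencil\<close>

theorem theorem1:
  fixes x :: "real^3 \<Rightarrow> real^4" and U :: "(real^3) set" and p :: "real^3"
    and E F G A B C L M N P T V :: real
  assumes "immersed_hypersurface x U"
    and "p \<in> U"
    and "first_form x p = vector [vector [E, F, A], vector [F, G, B], vector [A, B, C]]"
    and "second_form x p = vector [vector [L, M, P], vector [M, N, T], vector [P, T, V]]"
  shows "curvature 0 x p = 1
    \<and> curvature 1 x p =
        ((E*N + G*L - 2*F*M)*C + (E*G - F^2)*V - L*B^2 - N*A^2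
          - 2*(A*P*G - B*P*F - A*T*F + B*T*E - A*B*M))
        / (3*((E*G - F^2)*C - E*B^2 + 2*F*A*B - G*A^2))
    \<and> curvature 2 x p =
        ((E*N + G*L - 2*F*M)*V + (L*N - M^2)*C - E*T^2 - G*P^2
          - 2*(A*P*N - B*P*M - A*T*M + B*T*L - P*T*F))
        / (3*((E*G - F^2)*C - E*B^2 + 2*F*A*B - G*A^2))
    \<and> curvature 3 x p =
        ((L*N - M^2)*V - L*T^2 + 2*M*P*T - N*P^2)
        / ((E*G - F^2)*C - E*B^2 + 2*F*A*B - G*A^2)"
proof -
  define K H S where "K = first_form x p" and "H = second_form x p" and "S = shape_operator x p"
  have pos: "v \<bullet> (K *v v) > 0" if "v \<noteq> 0" for v
    unfolding K_def using first_form_positive[OF assms(1,2) that] .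
  then have inv: "invertible K" by (rule invertible_of_positive)
  then have KS: "K ** S = H"
    by (simp add: S_def shape_operator_def K_def H_def matrix_mul_assoc matrix_inv_right)
  have "transpose K = K" "transpose H = H"
    unfolding K_def H_def assms(3,4) by (rule transpose_symmetric_3)+
  then have real: "z \<in> \<real>" if "poly (map_poly of_real (charpoly S)) z = 0" for z :: complex
    using self_adjoint_pencil_roots_real[OF _ _ pos KS that] by blast
  have "charpoly S \<noteq> 0"
    using charpoly_3(1)[of S] by auto
  from real_rooted_splits[OF this real] have "size (eigenvalues S) = 3"
    and "charpoly S = - (\<Prod>k\<in>#eigenvalues S. [:-k, 1:])"
    \<comment> \<open>The leading coefficient is rewritten before the degree, because
      \<open>lead_coeff\<close> contains the degree.\<close>
    unfolding charpoly_3(2) unfolding charpoly_3(1) eigenvalues_def by auto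
  then obtain a b c where abc: "\<And>t. det (S - mat t) = (a - t) * (b - t) * (c - t)"
    and curv: "curvature 0 x p = 1" "curvature 1 x p = (a + b + c) / 3"
      "curvature 2 x p = (a * b + a * c + b * c) / 3" "curvature 3 x p = a * b * c"
    unfolding S_def by (rule curvatures_from_roots) blast
  \<comment> \<open>Multiplying by \<open>det K\<close> removes the inverse of \<open>K\<close>
    hidden in \<open>S\<close>: \<open>K ** (S - mat t)\<close> is
    \<open>H - t *\<^sub>R K\<close>.\<close>
  have pencil: "det K * ((a - t) * (b - t) * (c - t)) = det (H - t *\<^sub>R K)" for t
  proof -
    have "(\<Sum>k\<in>UNIV. K $ i $ k * (S - mat t) $ k $ j) =
        (\<Sum>k\<in>UNIV. K $ i $ k * S $ k $ j - (if k = j then t * K $ i $ j else 0))" for i j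
      by (intro sum.cong) (auto simp: mat_def algebra_simps)
    then have "K ** (S - mat t) = H - t *\<^sub>R K"
      by (simp add: KS[symmetric] vec_eq_iff matrix_matrix_mult_def sum_subtractf)
    then show ?thesis
      by (metis abc det_mul)
  qed
  have K: "K = vector [vector [E, F, A], vector [F, G, B], vector [A, B, C]]"
    and H: "H = vector [vector [L, M, P], vector [M, N, T], vector [P, T, V]]"
    by (simp_all add: K_def H_def assms)
  define d where "d = (E*G - F^2)*C - E*B^2 + 2*F*A*B - G*A^2"
  have d: "det K = d"
    by (simp add: K det_3 d_def algebra_simps power2_eq_square)
  have "d \<noteq> 0"
    using inv by (simp add: invertible_det_nz d)
  \<comment> \<open>Both sides are cubics in \<open>t\<close>. The values at 0, 1 and -1, together
    with the known cubic coefficient \<open>- d\<close>, determine the other three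
    coefficients.\<close>
  have expand: "d * ((a - t) * (b - t) * (c - t)) =
      (L - t*E) * (N - t*G) * (V - t*C) + 2 * (M - t*F) * (T - t*B) * (P - t*A)
      - (L - t*E) * (T - t*B)^2 - (N - t*G) * (P - t*A)^2 - (V - t*C) * (M - t*F)^2" for t
    using pencil[of t] unfolding d by (simp add: H K det_3 power2_eq_square mult_ac)
  have e3: "d * (a * b * c) = (L*N - M^2)*V - L*T^2 + 2*M*P*T - N*P^2"
    using expand[of 0] by (simp add: algebra_simps)
  have e1: "d * (a + b + c) = (E*N + G*L - 2*F*M)*C + (E*G - F^2)*V - L*B^2 - N*A^2
          - 2*(A*P*G - B*P*F - A*T*F + B*T*E - A*B*M)"
  proof -
    \<comment> \<open>Adding the values at 1 and -1 leaves twice the even part; the constant term is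
      known from \<open>e3\<close>. Writing \<open>a - -1\<close> keeps the shape of
      \<open>expand\<close> at -1.\<close>
    have "2 * (d * (a + b + c)) = d * ((a - 1) * (b - 1) * (c - 1)) + d * ((a - -1) * (b - -1) * (c - -1))
        - 2 * (d * (a * b * c))"
      by (simp add: algebra_simps)
    also have "\<dots> = 2 * ((E*N + G*L - 2*F*M)*C + (E*G - F^2)*V - L*B^2 - N*A^2
          - 2*(A*P*G - B*P*F - A*T*F + B*T*E - A*B*M))"
      unfolding expand e3 by (simp add: algebra_simps power2_eq_square)
    finally show ?thesis by (simp only: mult_cancel_left) simp
  qed
  have e2: "d * (a * b + a * c + b * c) = (E*N + G*L - 2*F*M)*V + (L*N - M^2)*C - E*T^2 - G*P^2
          - 2*(A*P*N - B*P*M - A*T*M + B*T*L - P*T*F)"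
  proof -
    \<comment> \<open>The difference of the values at -1 and 1 leaves the odd part, in which the
      cubic term contributes \<open>2 * d\<close>.\<close>
    have "2 * (d * (a * b + a * c + b * c)) = d * ((a - -1) * (b - -1) * (c - -1)) - d * ((a - 1) * (b - 1) * (c - 1))
        - 2 * d"
      by (simp add: algebra_simps)
    also have "\<dots> = 2 * ((E*N + G*L - 2*F*M)*V + (L*N - M^2)*C - E*T^2 - G*P^2
          - 2*(A*P*N - B*P*M - A*T*M + B*T*L - P*T*F))"
      \<comment> \<open>\<open>expand\<close> has to be applied while \<open>d\<close> is still
        folded, since its left-hand side contains \<open>d\<close>.\<close>
      unfolding expand unfolding d_def by (simp add: algebra_simps power2_eq_square)
    finally show ?thesis by (simp only: mult_cancel_left) simp
  qed
  show ?thesis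
    \<comment> \<open>Each numerator becomes \<open>d\<close> times a symmetric function of
      \<open>a\<close>, \<open>b\<close>, \<open>c\<close>, and the nonzero \<open>d\<close>
      cancels.\<close>
    unfolding curv d_def[symmetric] e1[symmetric] e2[symmetric] e3[symmetric]
    using \<open>d \<noteq> 0\<close> by simp
qed

end
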